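(* The category $\mathbf{Top}_w$ of all well-filtered spaces is adequate, i.e. for every $T_0$ space $X$ the space $P_H(\mathsf{WF}(X))$ is well-filtered. Therefore, for any $T_0$ space $X$, $X^w=P_H(\mathsf{WF}(X))$ with the canonical mapping $\eta_X: X\to X^w$, $x\mapsto\overline{\{x\}}$, is the well-filtered reflection of $X$.
   Context: A subset of a space is saturated if it is the intersection of all open sets containing it. $\mathsf{Q}(X)$ is the set of all nonempty compact saturated subsets of $X$. A family $\mathcal K\subseteq\mathsf{Q}(X)$ is filtered if it is nonempty and any two members of $\mathcal K$ contain a common member of $\mathcal K$. A space $X$ is well-filtered if it is $T_0$ and for every open set $U$ and every filtered family $\mathcal K\subseteq \mathsf{Q}(X)$, $\bigcap\mathcal K\subseteq U$ implies $K\subseteq U$ for some $K\in\mathcal K$. $\mathbf{Top}_w$ is the category of well-filtered spaces with continuous maps. For a $T_0$ space $X$, $\mathsf{WF}(X)$ is the set of all closed subsets $A\subseteq X$ such that for every continuous map $f:X\to Y$ to a well-filtered space $Y$ there is a unique $y_A\in Y$ with $\overline{f(A)}=\overline{\{y_A\}}$. $P_H(\mathsf{WF}(X))$ is $\mathsf{WF}(X)$ with the lower Vietoris topology, having as a subbase the sets $\{A\in \mathsf{WF}(X): A\cap U\neq\emptyset\}$, $U$ open in $X$. A well-filtered reflection of $X$ is a pair $\langle \widetilde X,\mu\rangle$ with $\widetilde X$ well-filtered and $\mu:X\to\widetilde X$ continuous such that for every continuous $f:X\to Y$ to a well-filtered space $Y$ there is a unique continuous $f^*:\widetilde X\to Y$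 with $f^*\circ\mu=f$. *)

theory Defs
  imports "HOL-Analysis.Analysis"
begin

section \<open>Well-filtered spaces\<close>

definition saturatedin :: "'a topology \<Rightarrow> 'a set \<Rightarrow> bool" where
  "saturatedin X S \<longleftrightarrow> S \<subseteq> topspace X \<and> S = \<Inter>{U. openin X U \<and> S \<subseteq> U}"

definition compact_saturated_sets :: "'a topology \<Rightarrow> 'a set set" where
  "compact_saturated_sets X = {K. K \<noteq> {} \<and> compactin X K \<and> saturatedin X K}"

definition filtered_family :: "'a set set \<Rightarrow> bool" where
  "filtered_family \<K> \<longleftrightarrow> \<K> \<noteq> {} \<and> (\<forall>K1\<in>\<K>. \<forall>K2\<in>\<K>. \<exists>K\<in>\<K>. K \<subseteq> K1 \<and> K \<subseteq> K2)"

definition well_filtered_space :: "'a topology \<Rightarrow> bool" where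
  "well_filtered_space X \<longleftrightarrow> t0_space X \<and>
     (\<forall>U \<K>. openin X U \<and> \<K> \<subseteq> compact_saturated_sets X \<and> filtered_family \<K> \<and> \<Inter>\<K> \<subseteq> U
        \<longrightarrow> (\<exists>K\<in>\<K>. K \<subseteq> U))"

section \<open>Well-filtered determined sets and the lower Vietoris topology\<close>

definition wf_determined :: "'b itself \<Rightarrow> 'a topology \<Rightarrow> 'a set \<Rightarrow> bool" where
  "wf_determined _ X A \<longleftrightarrow>
     (\<forall>(Y :: 'b topology) f. well_filtered_space Y \<and> continuous_map X Y f
        \<longrightarrow> (\<exists>!y. y \<in> topspace Y \<and> Y closure_of (f ` A) = Y closure_of {y}))"

text \<open>
  A definition cannot quantify over types, so the test spaces \<open>Y\<close> in the definition of \<open>WF X\<close>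
  live on one type, \<open>'a set\<close> for \<open>X :: 'a topology\<close>. This loses nothing: by the theorem
  \<open>WF_wf_determined\<close> below, members of \<open>WF X\<close> satisfy the defining condition for well-filtered
  test spaces over every type.
\<close>

definition WF :: "'a topology \<Rightarrow> 'a set set" where
  "WF X = {A. closedin X A \<and> wf_determined TYPE('a set) X A}"

definition lower_Vietoris :: "'a topology \<Rightarrow> 'a set set \<Rightarrow> 'a set topology" where
  "lower_Vietoris X \<A> =
     topology (arbitrary union_of
       (finite intersection_of (\<lambda>\<B>. \<exists>U. openin X U \<and> \<B> = {A \<in> \<A>. A \<inter> U \<noteq> {}})
        relative_to \<A>))"

section \<open>Well-filtered reflections\<close>

text \<open>
  Maps are total functions in HOL, so uniqueness of the extension is uniqueness on the carrier,
  expressed by restricting to \<open>extensional (topspace Xt)\<close>. The type \<open>'c\<close> of the target spaces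
  is a parameter; a theorem that leaves it free covers all well-filtered spaces.
\<close>

definition wf_reflection ::
    "'c itself \<Rightarrow> 'a topology \<Rightarrow> 'b topology \<Rightarrow> ('a \<Rightarrow> 'b) \<Rightarrow> bool" where
  "wf_reflection _ X Xt \<mu> \<longleftrightarrow>
     well_filtered_space Xt \<and> continuous_map X Xt \<mu> \<and>
     (\<forall>(Y :: 'c topology) f. well_filtered_space Y \<and> continuous_map X Y f
        \<longrightarrow> (\<exists>!g. g \<in> extensional (topspace Xt) \<and> continuous_map Xt Y g \<and>
                  (\<forall>x\<in>topspace X. g (\<mu> x) = f x)))"

definition point_closure :: "'a topology \<Rightarrow> 'a \<Rightarrow> 'a set" where
  "point_closure X x = X closure_of {x}"

section \<open>Independence of the type of the test spaces\<close>

lemma in_closure_of_singleton: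
  "y \<in> X closure_of {x} \<longleftrightarrow> y \<in> topspace X \<and> (\<forall>U. openin X U \<and> y \<in> U \<longrightarrow> x \<in> U)"
  by (auto simp: in_closure_of)

lemma minimal_closed_transversal:
  assumes comp: "\<And>k. k \<in> \<K> \<Longrightarrow> compactin Y k"
    and F: "closedin Y F" "\<And>k. k \<in> \<K> \<Longrightarrow> F \<inter> k \<noteq> {}"
    and ne: "\<K> \<noteq> {}"
  obtains C where "closedin Y C" "C \<subseteq> F" "\<And>k. k \<in> \<K> \<Longrightarrow> C \<inter> k \<noteq> {}"
    "\<And>D. closedin Y D \<Longrightarrow> D \<subseteq> C \<Longrightarrow> (\<And>k. k \<in> \<K> \<Longrightarrow> D \<inter> k \<noteq> {}) \<Longrightarrow> D = C"
proof -
  define P where "P C \<longleftrightarrow> closedin Y C \<and> C \<subseteq> F \<and> (\<forall>k\<in>\<K>. C \<inter> k \<noteq> {})" for C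
  define \<A> where "\<A> = {- C | C. P C}"
  have "\<exists>M\<in>\<A>. \<forall>X\<in>\<A>. M \<subseteq> X \<longrightarrow> X = M"
  proof (rule subset_Zorn_nonempty)
    show "\<A> \<noteq> {}"
      using F unfolding \<A>_def P_def by blast
  next
    fix \<C> assume \<C>: "\<C> \<noteq> {}" "subset.chain \<A> \<C>"
    define \<D> where "\<D> = uminus ` \<C>"
    have \<D>ne: "\<D> \<noteq> {}" using \<C> by (simp add: \<D>_def)
    have P\<D>: "P D" if "D \<in> \<D>" for D
      using that \<C>(2) unfolding \<D>_def \<A>_def subset.chain_def by fastforce
    have chain: "D \<subseteq> E \<or> E \<subseteq> D" if "D \<in> \<D>" "E \<in> \<D>" for D E
    proof -
      obtain M N where "M \<in> \<C>" "N \<in> \<C>" "D = - M" "E = - N"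
        using \<open>D \<in> \<D>\<close> \<open>E \<in> \<D>\<close> unfolding \<D>_def by blast
      then show ?thesis using \<C>(2) unfolding subset_chain_def by auto
    qed
    have fin: "\<Inter>\<E> \<in> \<D>" if "finite \<E>" "\<E> \<noteq> {}" "\<E> \<subseteq> \<D>" for \<E>
      using that
    proof (induction rule: finite_ne_induct)
      case (insert x E)
      then have "\<Inter>E \<in> \<D>" "x \<in> \<D>" by auto
      then have "x \<subseteq> \<Inter>E \<or> \<Inter>E \<subseteq> x" using chain by blast
      then show ?case
        using \<open>\<Inter>E \<in> \<D>\<close> \<open>x \<in> \<D>\<close> by (auto simp: inf.absorb1 inf.absorb2)
    qed auto
    have "\<Inter>\<D> \<inter> k \<noteq> {}" if k: "k \<in> \<K>" for k
    proof -
      have "k \<inter> \<Inter>\<D> \<noteq> {}"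
      proof -
        have "(\<forall>C\<in>\<D>. closedin Y C) \<and> (\<forall>\<F>. finite \<F> \<and> \<F> \<subseteq> \<D> \<longrightarrow> k \<inter> \<Inter>\<F> \<noteq> {})"
        proof (intro conjI ballI allI impI)
          fix \<F> assume f: "finite \<F> \<and> \<F> \<subseteq> \<D>"
          show "k \<inter> \<Inter>\<F> \<noteq> {}"
          proof (cases "\<F> = {}")
            case True
            then show ?thesis using F(2)[OF k] by auto
          next
            case False
            then have "P (\<Inter>\<F>)" using fin f P\<D> by blast
            then show ?thesis using k unfolding P_def by blast
          qed
        next
          fix C assume "C \<in> \<D>"
          then show "closedin Y C" using P\<D>[of C] by (simp add: P_def)
        qed
        then show ?thesis
          using comp[OF k] unfolding compactin_fip by simp
      qed
      then show ?thesis by blast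
    qed
    moreover have "closedin Y (\<Inter>\<D>)"
      using P\<D> by (intro closedin_Inter \<D>ne) (simp add: P_def)
    moreover obtain D where "D \<in> \<D>" using \<D>ne by blast
    then have "\<Inter>\<D> \<subseteq> F" using P\<D>[of D] by (auto simp: P_def)
    ultimately have "P (\<Inter>\<D>)" by (simp add: P_def)
    moreover have "- \<Inter>\<D> = \<Union>\<C>" unfolding \<D>_def by auto
    ultimately show "\<Union>\<C> \<in> \<A>"
      unfolding \<A>_def by (intro CollectI exI[of _ "\<Inter>\<D>"]) simp
  qed
  then obtain M where M: "M \<in> \<A>" "\<And>N. N \<in> \<A> \<Longrightarrow> M \<subseteq> N \<Longrightarrow> N = M" by meson
  then obtain C where MC: "M = - C" "P C" unfolding \<A>_def by blast
  have C: "P C" "\<And>D. P D \<Longrightarrow> - C \<subseteq> - D \<Longrightarrow> - D = - C"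
    using MC M(2) unfolding \<A>_def by auto
  show ?thesis
  proof (rule that)
    show "closedin Y C" "C \<subseteq> F" "\<And>k. k \<in> \<K> \<Longrightarrow> C \<inter> k \<noteq> {}"
      using C(1) unfolding P_def by auto
    show "D = C" if "closedin Y D" "D \<subseteq> C" "\<And>k. k \<in> \<K> \<Longrightarrow> D \<inter> k \<noteq> {}" for D
    proof -
      have "P D" using that C(1) unfolding P_def by blast
      then show ?thesis using C(2)[of D] that(2) by auto
    qed
  qed
qed

definition saturation_in :: "'a topology \<Rightarrow> 'a set \<Rightarrow> 'a set" where
  "saturation_in X B = {y \<in> topspace X. \<forall>U. openin X U \<and> B \<subseteq> U \<longrightarrow> y \<in> U}"

lemma saturation_in_superset: "B \<subseteq> topspace X \<Longrightarrow> B \<subseteq> saturation_in X B"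
  unfolding saturation_in_def by blast

lemma saturation_in_subset_open: "openin X U \<Longrightarrow> saturation_in X B \<subseteq> U \<longleftrightarrow> B \<subseteq> U"
  if "B \<subseteq> topspace X"
  using that saturation_in_superset unfolding saturation_in_def by blast

lemma saturation_in_mono: "A \<subseteq> B \<Longrightarrow> saturation_in X A \<subseteq> saturation_in X B"
  unfolding saturation_in_def by blast

lemma saturation_in_compact_saturated:
  assumes "compactin X B" "B \<noteq> {}"
  shows "saturation_in X B \<in> compact_saturated_sets X"
proof -
  have B: "B \<subseteq> topspace X" using assms compactin_subset_topspace by blast
  have "compactin X (saturation_in X B)"
    unfolding compactin_def
  proof (intro conjI allI impI)
    fix \<U> assume U: "Ball \<U> (openin X) \<and> saturation_in X B \<subseteq> \<Union>\<U>"
    then have "B \<subseteq> \<Union>\<U>" using saturation_in_superset[OF B] by blast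
    then obtain \<F> where "finite \<F>" "\<F> \<subseteq> \<U>" "B \<subseteq> \<Union>\<F>"
      using assms U unfolding compactin_def by meson
    moreover have "openin X (\<Union>\<F>)" using U \<open>\<F> \<subseteq> \<U>\<close> by blast
    ultimately show "\<exists>\<F>. finite \<F> \<and> \<F> \<subseteq> \<U> \<and> saturation_in X B \<subseteq> \<Union>\<F>"
      using saturation_in_subset_open[OF B] by (intro exI[of _ \<F>]) simp
  qed (auto simp: saturation_in_def)
  moreover have "saturatedin X (saturation_in X B)"
  proof -
    have "saturation_in X B = \<Inter>{U. openin X U \<and> B \<subseteq> U}"
      using openin_topspace[of X] B unfolding saturation_in_def by auto
    moreover have "{U. openin X U \<and> B \<subseteq> U} = {U. openin X U \<and> saturation_in X B \<subseteq> U}"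
      using saturation_in_subset_open[OF B] by auto
    moreover have "saturation_in X B \<subseteq> topspace X" by (auto simp: saturation_in_def)
    ultimately show ?thesis unfolding saturatedin_def by simp
  qed
  ultimately show ?thesis
    unfolding compact_saturated_sets_def using saturation_in_superset[OF B] assms by blast
qed

text \<open>The subspace \<open>S\<close> below is the closure of \<open>B\<close> in the strong (or b-) topology of \<open>Y\<close>.\<close>

lemma well_filtered_space_strong_closure:
  fixes Y :: "'a topology"
  assumes wf: "well_filtered_space Y" and B: "B \<subseteq> topspace Y"
  defines "S \<equiv> {y \<in> topspace Y. Y closure_of {y} = Y closure_of (Y closure_of {y} \<inter> B)}"
  shows "well_filtered_space (subtopology Y S)"
  unfolding well_filtered_space_def
proof (intro conjI allI impI)
  show "t0_space (subtopology Y S)"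
    using wf by (simp add: well_filtered_space_def t0_space_subtopology)
next
  fix U \<K>
  assume H: "openin (subtopology Y S) U \<and> \<K> \<subseteq> compact_saturated_sets (subtopology Y S) \<and>
    filtered_family \<K> \<and> \<Inter>\<K> \<subseteq> U"
  then obtain V where V: "openin Y V" "U = V \<inter> S"
    unfolding openin_subtopology by auto
  have Sub: "S \<subseteq> topspace Y" by (auto simp: S_def)
  have k: "compactin Y k" "k \<subseteq> S" "k \<noteq> {}" "saturatedin (subtopology Y S) k" if "k \<in> \<K>" for k
    using that H unfolding compact_saturated_sets_def by (auto simp: compactin_subtopology)
  show "\<exists>K\<in>\<K>. K \<subseteq> U"
  proof (rule ccontr)
    assume non: "\<not> (\<exists>K\<in>\<K>. K \<subseteq> U)"
    have \<K>ne: "\<K> \<noteq> {}" using H unfolding filtered_family_def by blast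
    have clF: "closedin Y (topspace Y - V)" using V by blast
    have Fk: "(topspace Y - V) \<inter> k \<noteq> {}" if "k \<in> \<K>" for k
      using non that k(2)[OF that] V(2) Sub by blast
    obtain C where C: "closedin Y C" "C \<subseteq> topspace Y - V"
      and Ck: "\<And>k. k \<in> \<K> \<Longrightarrow> C \<inter> k \<noteq> {}"
      and min: "\<And>D. closedin Y D \<Longrightarrow> D \<subseteq> C \<Longrightarrow> (\<And>k. k \<in> \<K> \<Longrightarrow> D \<inter> k \<noteq> {}) \<Longrightarrow> D = C"
      using minimal_closed_transversal[OF k(1) clF Fk \<K>ne] by metis
    have Csub: "C \<subseteq> topspace Y" using C(2) by blast
    define \<L> where "\<L> = (\<lambda>k. saturation_in Y (C \<inter> k)) ` \<K>"
    have "\<L> \<subseteq> compact_saturated_sets Y"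
      unfolding \<L>_def
      using saturation_in_compact_saturated closed_Int_compactin[OF C(1) k(1)] Ck by blast
    moreover have "filtered_family \<L>"
      unfolding filtered_family_def
    proof (intro conjI ballI)
      show "\<L> \<noteq> {}" using \<K>ne by (simp add: \<L>_def)
      fix L1 L2 assume "L1 \<in> \<L>" "L2 \<in> \<L>"
      then obtain k1 k2 where 12: "k1 \<in> \<K>" "k2 \<in> \<K>" "L1 = saturation_in Y (C \<inter> k1)"
        "L2 = saturation_in Y (C \<inter> k2)" unfolding \<L>_def by blast
      then obtain k3 where "k3 \<in> \<K>" "k3 \<subseteq> k1" "k3 \<subseteq> k2"
        using H unfolding filtered_family_def by blast
      then show "\<exists>K\<in>\<L>. K \<subseteq> L1 \<and> K \<subseteq> L2"
        unfolding \<L>_def 12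
        by (intro bexI[of _ "saturation_in Y (C \<inter> k3)"] conjI saturation_in_mono) auto
    qed
    moreover have "\<not> (\<exists>L\<in>\<L>. L \<subseteq> topspace Y - C)"
    proof
      assume "\<exists>L\<in>\<L>. L \<subseteq> topspace Y - C"
      then obtain k0 where k0: "k0 \<in> \<K>" "saturation_in Y (C \<inter> k0) \<subseteq> topspace Y - C"
        unfolding \<L>_def by blast
      have "C \<inter> k0 \<subseteq> saturation_in Y (C \<inter> k0)"
        using Csub by (intro saturation_in_superset) blast
      then show False using k0 Ck[OF k0(1)] by blast
    qed
    moreover have "openin Y (topspace Y - C)" using C(1) by blast
    ultimately have "\<not> \<Inter>\<L> \<subseteq> topspace Y - C"
      using wf unfolding well_filtered_space_def by blast
    then obtain y where y: "y \<in> \<Inter>\<L>" "y \<notin> topspace Y - C" by blast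
    have yT: "y \<in> topspace Y" using y(1) \<K>ne unfolding \<L>_def saturation_in_def by blast
    with y have yC: "y \<in> C" by blast
    have clyC: "Y closure_of {y} \<subseteq> C" using yC C(1) by (simp add: closure_of_minimal)
    have meet: "Y closure_of {y} \<inter> k \<noteq> {}" if "k \<in> \<K>" for k
    proof
      assume e: "Y closure_of {y} \<inter> k = {}"
      have "C \<inter> k \<subseteq> topspace Y - Y closure_of {y}" using e Csub by blast
      moreover have "openin Y (topspace Y - Y closure_of {y})" using closedin_closure_of by (intro openin_diff) auto
      moreover have "y \<in> saturation_in Y (C \<inter> k)" using y(1) that unfolding \<L>_def by blast
      ultimately have "y \<in> topspace Y - Y closure_of {y}" unfolding saturation_in_def by blast
      then show False using yT by (simp add: in_closure_of_singleton)
    qed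
    have Cy: "Y closure_of {y} = C"
      by (rule min) (use clyC meet in auto)
    have CS: "Y closure_of (C \<inter> S) = C"
    proof (rule min)
      show "Y closure_of (C \<inter> S) \<subseteq> C" using C(1) by (simp add: closure_of_minimal)
      show "Y closure_of (C \<inter> S) \<inter> k \<noteq> {}" if "k \<in> \<K>" for k
      proof -
        have "C \<inter> S \<subseteq> Y closure_of (C \<inter> S)" using Sub by (intro closure_of_subset) blast
        then show ?thesis using Ck[OF that] k(2)[OF that] by blast
      qed
    qed auto
    have "C \<inter> S \<subseteq> Y closure_of (C \<inter> B)"
    proof
      fix s assume s: "s \<in> C \<inter> S"
      have "Y closure_of {s} \<subseteq> C" using s C(1) by (simp add: closure_of_minimal)
      then have "Y closure_of (Y closure_of {s} \<inter> B) \<subseteq> Y closure_of (C \<inter> B)"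
        by (intro closure_of_mono) blast
      moreover have "s \<in> Y closure_of {s}" using s Sub by (auto simp: in_closure_of_singleton)
      ultimately show "s \<in> Y closure_of (C \<inter> B)" using s unfolding S_def by auto
    qed
    then have "C \<subseteq> Y closure_of (C \<inter> B)"
      using CS closure_of_minimal closedin_closure_of by metis
    moreover have "Y closure_of (C \<inter> B) \<subseteq> C" using C(1) by (simp add: closure_of_minimal)
    ultimately have yS: "y \<in> S" using yT Cy unfolding S_def by auto
    have "y \<in> k" if kK: "k \<in> \<K>" for k
    proof -
      obtain p where p: "p \<in> k" "p \<in> Y closure_of {y}" using meet[OF kK] by blast
      have "y \<in> W" if W: "openin (subtopology Y S) W" "k \<subseteq> W" for W
      proof -
        obtain W' where "openin Y W'" "W = W' \<inter> S" using W(1) unfolding openin_subtopology by auto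
        then show ?thesis using p W(2) yS unfolding in_closure_of_singleton by blast
      qed
      then have "y \<in> \<Inter>{W. openin (subtopology Y S) W \<and> k \<subseteq> W}" by blast
      then show ?thesis using k(4)[OF kK] unfolding saturatedin_def by blast
    qed
    then have "y \<in> V" using H V(2) by blast
    then show False using yC C(2) by blast
  qed
qed

lemma well_filtered_space_homeomorphic_map:
  assumes wf: "well_filtered_space X" and h: "homeomorphic_map X Y h"
  shows "well_filtered_space Y"
  unfolding well_filtered_space_def
proof (intro conjI allI impI)
  show "t0_space Y"
    using wf homeomorphic_t0_space[OF homeomorphic_map_imp_homeomorphic_space[OF h]]
    by (simp add: well_filtered_space_def)
next
  obtain g where gh: "homeomorphic_maps X Y h g" using h homeomorphic_map_maps by blast
  then have g: "homeomorphic_map Y X g"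
    using homeomorphic_maps_map homeomorphic_maps_sym by blast
  have hg: "h (g y) = y" if "y \<in> topspace Y" for y
    using gh that by (simp add: homeomorphic_maps_def)
  have gX: "g y \<in> topspace X" if "y \<in> topspace Y" for y
    using homeomorphic_imp_surjective_map[OF g] that by blast
  have openg: "openin X (g ` U)" if "openin Y U" for U
    using homeomorphic_imp_open_map[OF g] that by (simp add: open_map_def)
  fix U \<K>
  assume H: "openin Y U \<and> \<K> \<subseteq> compact_saturated_sets Y \<and> filtered_family \<K> \<and> \<Inter>\<K> \<subseteq> U"
  have kT: "k \<subseteq> topspace Y" if "k \<in> \<K>" for k
    using H that unfolding compact_saturated_sets_def saturatedin_def by blast
  have hgk: "h ` g ` k = k" if "k \<subseteq> topspace Y" for k
    using hg that by (force simp: image_iff)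
  have "g ` k \<in> compact_saturated_sets X" if k: "k \<in> \<K>" for k
  proof -
    have kk: "k \<noteq> {}" "compactin Y k" "saturatedin Y k"
      using H k unfolding compact_saturated_sets_def by auto
    have "compactin X (g ` k)"
      using kk g homeomorphic_imp_continuous_map image_compactin by blast
    moreover have "saturatedin X (g ` k)"
      unfolding saturatedin_def
    proof (intro conjI equalityI subsetI)
      fix x assume x: "x \<in> \<Inter>{U. openin X U \<and> g ` k \<subseteq> U}"
      have xT: "x \<in> topspace X" using x gX kT[OF k] by blast
      have "h x \<in> W" if "openin Y W" "k \<subseteq> W" for W
      proof -
        have "x \<in> g ` W" using x openg[OF that(1)] that(2) by blast
        then show ?thesis using hg that(1) openin_subset by (metis (no_types, lifting) imageE subsetD)
      qed
      then have "h x \<in> k" using kk(3) unfolding saturatedin_def by blast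
      moreover have "g (h x) = x" using gh xT by (simp add: homeomorphic_maps_def)
      ultimately show "x \<in> g ` k" by (metis imageI)
    qed (use gX kT[OF k] in auto)
    ultimately show ?thesis using kk(1) unfolding compact_saturated_sets_def by blast
  qed
  then have "(`) g ` \<K> \<subseteq> compact_saturated_sets X" by blast
  moreover have "filtered_family ((`) g ` \<K>)"
    unfolding filtered_family_def
  proof (intro conjI ballI)
    show "(`) g ` \<K> \<noteq> {}" using H by (simp add: filtered_family_def)
    fix L1 L2 assume "L1 \<in> (`) g ` \<K>" "L2 \<in> (`) g ` \<K>"
    then obtain k1 k2 where 12: "k1 \<in> \<K>" "k2 \<in> \<K>" "L1 = g ` k1" "L2 = g ` k2" by blast
    then obtain k3 where "k3 \<in> \<K>" "k3 \<subseteq> k1" "k3 \<subseteq> k2"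
      using H unfolding filtered_family_def by meson
    then show "\<exists>K\<in>(`) g ` \<K>. K \<subseteq> L1 \<and> K \<subseteq> L2" 
      unfolding 12 by (meson image_eqI image_mono)
  qed
  moreover have "\<Inter>((`) g ` \<K>) \<subseteq> g ` U"
  proof
    fix x assume x: "x \<in> \<Inter>((`) g ` \<K>)"
    have "h x \<in> k" if "k \<in> \<K>" for k
      using x that hgk[OF kT[OF that]] by blast
    then have "h x \<in> U" using H by blast
    moreover have "x \<in> topspace X"
    proof -
      obtain k where "k \<in> \<K>" using H by (auto simp: filtered_family_def)
      then show ?thesis using x gX kT by blast
    qed
    then have "g (h x) = x" using gh by (simp add: homeomorphic_maps_def)
    ultimately show "x \<in> g ` U" by (metis imageI)
  qed
  moreover have "openin X (g ` U)" using openg H by blast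
  ultimately have "\<exists>L\<in>(`) g ` \<K>. L \<subseteq> g ` U"
    using wf unfolding well_filtered_space_def by blast
  then obtain k where k: "k \<in> \<K>" "g ` k \<subseteq> g ` U" by blast
  then have "h ` g ` k \<subseteq> h ` g ` U" by blast
  then show "\<exists>K\<in>\<K>. K \<subseteq> U"
    using k(1) hgk kT H openin_subset by metis
qed

theorem WF_wf_determined:
  fixes X :: "'a topology"
  assumes "A \<in> WF X"
  shows "wf_determined TYPE('c) X A"
  unfolding wf_determined_def
proof (intro allI impI)
  fix Y :: "'c topology" and f
  assume H: "well_filtered_space Y \<and> continuous_map X Y f"
  have A: "A \<subseteq> topspace X" "wf_determined TYPE('a set) X A"
    using assms closedin_subset unfolding WF_def by auto
  have cf: "continuous_map X Y f" and t0: "t0_space Y"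
    using H unfolding well_filtered_space_def by auto
  define B where "B = f ` topspace X"
  have B: "B \<subseteq> topspace Y" using cf continuous_map_image_subset_topspace unfolding B_def by blast
  define S where "S = {y \<in> topspace Y. Y closure_of {y} = Y closure_of (Y closure_of {y} \<inter> B)}"
  have Sub: "S \<subseteq> topspace Y" by (auto simp: S_def)
  have BS: "B \<subseteq> S"
  proof
    fix b assume b: "b \<in> B"
    then have bT: "b \<in> topspace Y" using B by blast
    have "b \<in> Y closure_of {b}" using bT by (simp add: in_closure_of_singleton)
    then have "Y closure_of {b} \<subseteq> Y closure_of (Y closure_of {b} \<inter> B)"
      using b by (intro closure_of_mono) blast
    moreover have "Y closure_of (Y closure_of {b} \<inter> B) \<subseteq> Y closure_of {b}"
      by (simp add: closure_of_minimal)
    ultimately show "b \<in> S" using bT unfolding S_def by blast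
  qed
  define \<phi> where "\<phi> y = {x \<in> topspace X. f x \<in> Y closure_of {y}}" for y
  have inj: "inj_on \<phi> S"
  proof (rule inj_onI)
    fix y z assume yz: "y \<in> S" "z \<in> S" "\<phi> y = \<phi> z"
    have "f ` \<phi> y = Y closure_of {y} \<inter> B" for y unfolding \<phi>_def B_def by blast
    then have "Y closure_of {y} \<inter> B = Y closure_of {z} \<inter> B" using yz(3) by metis
    then have "Y closure_of {y} = Y closure_of {z}" using yz unfolding S_def by auto
    then show "y = z" using t0 yz Sub unfolding t0_space_closure_of_sing by blast
  qed
  define YS where "YS = subtopology Y S"
  have tYS: "topspace YS = S" using Sub unfolding YS_def by auto
  define g where "g = inv_into S \<phi>"
  have g\<phi>: "g (\<phi> y) = y" if "y \<in> S" for y using inj that by (simp add: g_def)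
  define Z where "Z = pullback_topology (\<phi> ` S) g YS"
  have tZ: "topspace Z = \<phi> ` S"
    unfolding Z_def topspace_pullback_topology tYS using g\<phi> by auto
  have oZ: "openin Z W \<longleftrightarrow> (\<exists>U. openin YS U \<and> W = \<phi> ` U)" for W
  proof -
    have "g -` U \<inter> \<phi> ` S = \<phi> ` U" if "openin YS U" for U
      using openin_subset[OF that] g\<phi> unfolding tYS by force
    then show ?thesis unfolding Z_def openin_pullback_topology by metis
  qed
  have h: "homeomorphic_map YS Z \<phi>"
  proof (rule bijective_open_imp_homeomorphic_map)
    show "continuous_map YS Z \<phi>"
      unfolding continuous_map_def
    proof (intro conjI allI impI)
      show "\<phi> \<in> topspace YS \<rightarrow> topspace Z" using tYS tZ by auto
      fix W assume "openin Z W"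
      then obtain U where U: "openin YS U" "W = \<phi> ` U" using oZ by blast
      have "{x \<in> topspace YS. \<phi> x \<in> W} = U"
        using openin_subset[OF U(1)] inj unfolding U(2) tYS inj_on_def by blast
      then show "openin YS {x \<in> topspace YS. \<phi> x \<in> W}" using U by simp
    qed
    show "open_map YS Z \<phi>" unfolding open_map_def using oZ by blast
  qed (use tYS tZ inj in auto)
  have wfZ: "well_filtered_space Z"
    using well_filtered_space_homeomorphic_map[OF _ h] well_filtered_space_strong_closure[OF _ B] H
    unfolding YS_def S_def by blast
  have "continuous_map X YS f"
    using cf BS unfolding YS_def B_def by (auto simp: continuous_map_in_subtopology)
  then have "continuous_map X Z (\<phi> \<circ> f)"
    using h homeomorphic_imp_continuous_map continuous_map_compose by blast
  then obtain z where z: "z \<in> topspace Z" "Z closure_of ((\<phi> \<circ> f) ` A) = Z closure_of {z}"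
    using A(2) wfZ unfolding wf_determined_def by blast
  obtain y where y: "y \<in> S" "z = \<phi> y" using z(1) tZ by blast
  have fA: "f ` A \<subseteq> S" using A(1) BS unfolding B_def by blast
  have "\<phi> ` (YS closure_of (f ` A)) = Z closure_of (\<phi> ` f ` A)"
    using homeomorphic_map_closure_of[OF h] fA tYS by metis
  moreover have "\<phi> ` (YS closure_of {y}) = Z closure_of (\<phi> ` {y})"
    using homeomorphic_map_closure_of[OF h, of "{y}"] y tYS by auto
  ultimately have "\<phi> ` (YS closure_of (f ` A)) = \<phi> ` (YS closure_of {y})"
    using z(2) y(2) by (simp add: image_comp)
  moreover have "YS closure_of T \<subseteq> S" for T
    using closure_of_subset_topspace[of YS T] tYS by simp
  ultimately have YSeq: "YS closure_of (f ` A) = YS closure_of {y}"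
    using inj by (simp add: inj_on_image_eq_iff)
  have "S \<inter> Y closure_of (f ` A) = S \<inter> Y closure_of {y}"
    using YSeq fA y(1) unfolding YS_def closure_of_subtopology by (simp add: Int_absorb1)
  moreover have "f ` A \<subseteq> Y closure_of (f ` A)" "y \<in> Y closure_of {y}"
    using fA Sub y closure_of_subset[of "f ` A" Y] by (auto simp: in_closure_of_singleton)
  ultimately have "f ` A \<subseteq> Y closure_of {y}" "{y} \<subseteq> Y closure_of (f ` A)"
    using fA y by blast+
  then have "Y closure_of (f ` A) = Y closure_of {y}"
    by (meson closedin_closure_of closure_of_minimal equalityI)
  moreover have "y' = y" if "y' \<in> topspace Y" "Y closure_of {y'} = Y closure_of {y}" for y'
    using t0 that y Sub unfolding t0_space_closure_of_sing by blast
  ultimately show "\<exists>!y. y \<in> topspace Y \<and> Y closure_of (f ` A) = Y closure_of {y}"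
    using y Sub by (intro ex1I[of _ y]) auto
qed

end

theory Submission
  imports Defs
begin

text \<open>
  A continuous map \<open>f : X \<rightarrow> Y\<close> into a well-filtered space extends to \<open>WF X\<close> by sending \<open>A\<close> to the
  unique \<open>y\<close> with the same closure as \<open>f(A)\<close>. To see that \<open>WF X\<close> is well-filtered, suppose that no
  member of a filtered family of compact saturated sets lies in a given open set. By Zorn (Rudin's
  lemma) there is a minimal closed family \<open>\<C>\<close> in the complement that meets every member. By
  minimality, the image of \<open>\<C>\<close> under any continuous map to a well-filtered space is dense in the
  closure of a point. Applied to the extensions of maps on \<open>X\<close>, this shows that the closed set
  \<open>C = \<Union>\<C>\<close> belongs to \<open>WF X\<close>. Hence \<open>C\<close> is the generic point of \<open>\<C>\<close> and lies in every member of the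
  filtered family, although it is not in the open set.
\<close>

section \<open>Finite test spaces\<close>

lemma filtered_familyD:
  assumes "filtered_family \<K>" "K1 \<in> \<K>" "K2 \<in> \<K>"
  obtains K where "K \<in> \<K>" "K \<subseteq> K1" "K \<subseteq> K2"
  using assms unfolding filtered_family_def by blast

text \<open>By finiteness there is a minimal member; a common member below it and any
  \<open>K\<close> must be the minimal one itself, so that one is least.\<close>

lemma finite_filtered_family_Inter_mem:
  assumes "finite \<K>" "filtered_family \<K>"
  shows "\<Inter>\<K> \<in> \<K>"
proof -
  have "\<K> \<noteq> {}" using assms(2) unfolding filtered_family_def by (rule conjunct1)
  from finite_has_minimal[OF assms(1) this]
  obtain M where M: "M \<in> \<K>" "\<forall>K\<in>\<K>. K \<subseteq> M \<longrightarrow> M = K" ..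
  have "M \<subseteq> K" if K: "K \<in> \<K>" for K
  proof -
    obtain N where N: "N \<in> \<K>" "N \<subseteq> M" "N \<subseteq> K" using filtered_familyD[OF assms(2) M(1) K] .
    then have "M = N" using bspec[OF M(2) N(1)] by simp
    then show ?thesis using N(3) by simp
  qed
  then have "\<Inter>\<K> = M" using M(1) by (intro equalityI Inter_lower Inter_greatest)
  then show ?thesis using M(1) by simp
qed

text \<open>Over a finite carrier every filtered family is finite, so its intersection is one of its
  members.\<close>

lemma well_filtered_space_finite:
  assumes "t0_space X" "finite (topspace X)"
  shows "well_filtered_space X"
  unfolding well_filtered_space_def
proof (intro conjI allI impI)
  fix U \<K>
  assume H: "openin X U \<and> \<K> \<subseteq> compact_saturated_sets X \<and> filtered_family \<K> \<and> \<Inter>\<K> \<subseteq> U"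
  have "\<K> \<subseteq> Pow (topspace X)"
    using H unfolding compact_saturated_sets_def saturatedin_def by blast
  then have "finite \<K>" using assms(2) finite_subset by auto
  then have "\<Inter>\<K> \<in> \<K>" using H by (intro finite_filtered_family_Inter_mem) auto
  then show "\<exists>K\<in>\<K>. K \<subseteq> U" using H by (intro bexI[of _ "\<Inter>\<K>"]) auto
qed (rule assms(1))

text \<open>This is the Alexandrov topology of inclusion. Over a finite type \<open>'a\<close> it is
  the power of the Sierpinski space with exponent \<open>'a\<close>.\<close>

definition upper_topology :: "'a set topology" where
  "upper_topology = topology (\<lambda>\<W>. \<forall>S\<in>\<W>. \<forall>T. S \<subseteq> T \<longrightarrow> T \<in> \<W>)"

lemma openin_upper_topology:
  "openin upper_topology \<W> \<longleftrightarrow> (\<forall>S\<in>\<W>. \<forall>T. S \<subseteq> T \<longrightarrow> T \<in> \<W>)"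
proof -
  have "istopology (\<lambda>\<W>::'a set set. \<forall>S\<in>\<W>. \<forall>T. S \<subseteq> T \<longrightarrow> T \<in> \<W>)"
    unfolding istopology_def by blast
  then show ?thesis unfolding upper_topology_def by (simp add: topology_inverse')
qed

lemma topspace_upper_topology [simp]: "topspace upper_topology = UNIV"
  using openin_subset[of upper_topology UNIV] by (auto simp: openin_upper_topology)

text \<open>Each \<open>S\<close> has a least open neighbourhood, the family of its supersets, so
  closures are down-closures.\<close>

lemma in_closure_of_upper_topology:
  "S \<in> upper_topology closure_of \<A> \<longleftrightarrow> (\<exists>T\<in>\<A>. S \<subseteq> T)"
proof
  assume S: "S \<in> upper_topology closure_of \<A>"
  have "openin upper_topology {T. S \<subseteq> T}" unfolding openin_upper_topology by blast
  then show "\<exists>T\<in>\<A>. S \<subseteq> T" using S unfolding in_closure_of by blast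
next
  assume "\<exists>T\<in>\<A>. S \<subseteq> T"
  then show "S \<in> upper_topology closure_of \<A>"
    unfolding in_closure_of openin_upper_topology by (simp; blast)
qed

lemma well_filtered_space_upper_topology:
  "well_filtered_space (upper_topology :: 'a::finite set topology)"
proof (rule well_filtered_space_finite)
  show "t0_space (upper_topology :: 'a set topology)"
    unfolding t0_space_closure_of_sing by (auto simp: set_eq_iff in_closure_of_upper_topology)
qed simp

section \<open>Nonemptiness and irreducibility of the members of \<open>WF X\<close>\<close>

lemma WF_closedin: "A \<in> WF X \<Longrightarrow> closedin X A"
  by (simp add: WF_def)

text \<open>A constant map suffices: the image of the empty set has empty closure, but a point lies
  in its own closure. By \<open>WF_wf_determined\<close> the test space may live over
  \<open>bool set\<close>.\<close>

lemma WF_imp_nonempty: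
  assumes "A \<in> WF X"
  shows "A \<noteq> {}"
proof
  assume "A = {}"
  moreover have "continuous_map X (upper_topology :: bool set topology) (\<lambda>_. {})"
    by simp
  ultimately obtain y :: "bool set"
    where "upper_topology closure_of {} = upper_topology closure_of {y}"
    using WF_wf_determined[OF assms, where ?'c = "bool set"] well_filtered_space_upper_topology
    unfolding wf_determined_def by (metis image_empty)
  then show False using in_closure_of_upper_topology[of y "{y}"] by simp
qed

text \<open>The pair of open sets is a continuous map to the square of the Sierpinski space.\<close>

lemma WF_irreducible:
  assumes A: "A \<in> WF X" and U: "openin X U" "A \<inter> U \<noteq> {}" and V: "openin X V" "A \<inter> V \<noteq> {}"
  shows "A \<inter> (U \<inter> V) \<noteq> {}"
proof -
  \<comment> \<open>The element \<open>True\<close> records membership in \<open>U\<close>, and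
    \<open>False\<close> records membership in \<open>V\<close>.\<close>
  define f where "f x = {b. if b then x \<in> U else x \<in> V}" for x
  have "continuous_map X upper_topology f"
    unfolding continuous_map_def
  proof (intro conjI allI impI)
    fix \<W> :: "bool set set" assume \<W>: "openin upper_topology \<W>"
    show "openin X {x \<in> topspace X. f x \<in> \<W>}"
    proof (subst openin_subopen, intro ballI)
      fix x assume x: "x \<in> {x \<in> topspace X. f x \<in> \<W>}"
      \<comment> \<open>Only those of \<open>U\<close> and \<open>V\<close> that contain
        \<open>x\<close> are imposed, so no element of \<open>f x\<close> is lost anywhere on
        \<open>N\<close>.\<close>
      define N where "N = (if x \<in> U then U else topspace X) \<inter> (if x \<in> V then V else topspace X)"
      have "openin X N" "x \<in> N" using U V x unfolding N_def by auto
      moreover have "z \<in> {x \<in> topspace X. f x \<in> \<W>}" if "z \<in> N" for z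
      proof -
        have "f x \<subseteq> f z"
          using that unfolding N_def f_def by (auto split: if_splits)
        moreover have "f x \<in> \<W>" using x by simp
        ultimately have "f z \<in> \<W>" using \<W> unfolding openin_upper_topology by blast
        then show ?thesis using that openin_subset[OF \<open>openin X N\<close>] by blast
      qed
      then have "N \<subseteq> {x \<in> topspace X. f x \<in> \<W>}" by (rule subsetI)
      ultimately show "\<exists>T. openin X T \<and> x \<in> T \<and> T \<subseteq> {x \<in> topspace X. f x \<in> \<W>}" by blast
    qed
  qed simp
  then obtain y where y: "upper_topology closure_of (f ` A) = upper_topology closure_of {y}"
    using WF_wf_determined[OF A] well_filtered_space_upper_topology
    unfolding wf_determined_def by blast
  \<comment> \<open>Equal closures are equal down-sets, so \<open>y\<close> is the greatest value of
    \<open>f\<close> on \<open>A\<close>. A point of \<open>A\<close> attaining it lies in both open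
    sets.\<close>
  then have iff: "(\<exists>x\<in>A. S \<subseteq> f x) \<longleftrightarrow> S \<subseteq> y" for S
    using in_closure_of_upper_topology[of S "f ` A"] in_closure_of_upper_topology[of S "{y}"]
    by simp
  have "{True} \<subseteq> y" "{False} \<subseteq> y"
    using U V unfolding iff[symmetric] f_def by auto
  then have "{True, False} \<subseteq> y" by simp
  then obtain x where "x \<in> A" "{True, False} \<subseteq> f x" unfolding iff[symmetric] by blast
  then show ?thesis unfolding f_def by auto
qed

section \<open>Open sets and separation in the lower Vietoris space\<close>

text \<open>The subbase is already the whole topology: irreducibility gives binary intersections,
  nonemptiness gives the empty one, and a set hits a union iff it hits one of the parts.\<close>

lemma openin_lower_Vietoris_WF:
  "openin (lower_Vietoris X (WF X)) \<S> \<longleftrightarrow> (\<exists>U. openin X U \<and> \<S> = {A \<in> WF X. A \<inter> U \<noteq> {}})"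
proof -
  define P where "P \<B> \<longleftrightarrow> (\<exists>U. openin X U \<and> \<B> = {A \<in> WF X. A \<inter> U \<noteq> {}})" for \<B>
  have open_eq: "openin (lower_Vietoris X (WF X)) =
      arbitrary union_of (finite intersection_of P relative_to WF X)"
    unfolding lower_Vietoris_def P_def by (intro topology_inverse' istopology_subbase)
  have P_WF: "P (WF X)"
  proof -
    have "A \<inter> topspace X \<noteq> {}" if "A \<in> WF X" for A
      using WF_imp_nonempty[OF that] closedin_subset[OF WF_closedin[OF that]] by blast
    then show ?thesis unfolding P_def by (intro exI[of _ "topspace X"]) auto
  qed
  have P_Int: "P (\<B> \<inter> \<B>')" if "P \<B>" "P \<B>'" for \<B> \<B>'
  proof -
    from that obtain U V where UV: "openin X U" "openin X V"
      "\<B> = {A \<in> WF X. A \<inter> U \<noteq> {}}" "\<B>' = {A \<in> WF X. A \<inter> V \<noteq> {}}"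
      unfolding P_def by blast
    have "\<B> \<inter> \<B>' = {A \<in> WF X. A \<inter> (U \<inter> V) \<noteq> {}}"
    proof (intro equalityI subsetI)
      fix A assume "A \<in> \<B> \<inter> \<B>'"
      then have "A \<in> WF X" "A \<inter> U \<noteq> {}" "A \<inter> V \<noteq> {}" unfolding UV(3,4) by simp_all
      then show "A \<in> {A \<in> WF X. A \<inter> (U \<inter> V) \<noteq> {}}"
        using WF_irreducible[of A X U V] UV(1,2) by simp
    qed (use UV(3,4) in auto)
    then show ?thesis using UV(1,2) unfolding P_def by blast
  qed
  have P_finite: "P (WF X \<inter> \<Inter>\<F>)" if "finite \<F>" "\<F> \<subseteq> Collect P" for \<F>
    using that
  proof (induction rule: finite_induct)
    case (insert \<B> \<F>)
    then have "P \<B>" "P (WF X \<inter> \<Inter>\<F>)" by simp_all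
    then have "P (\<B> \<inter> (WF X \<inter> \<Inter>\<F>))" by (rule P_Int)
    then show ?case by (simp add: Int_left_commute)
  qed (simp add: P_WF)
  have P_Union: "P (\<Union>\<F>)" if "\<F> \<subseteq> Collect P" for \<F>
  proof -
    \<comment> \<open>Taking every open set that represents a member of \<open>\<F>\<close> avoids
      choosing one for each member.\<close>
    define \<V> where "\<V> = {U. openin X U \<and> {A \<in> WF X. A \<inter> U \<noteq> {}} \<in> \<F>}"
    have "\<Union>\<F> = {A \<in> WF X. A \<inter> \<Union>\<V> \<noteq> {}}"
      using that unfolding P_def \<V>_def by blast
    moreover have "openin X (\<Union>\<V>)" unfolding \<V>_def by blast
    ultimately show ?thesis unfolding P_def by blast
  qed
  have "openin (lower_Vietoris X (WF X)) \<S> \<longleftrightarrow> P \<S>"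
  proof
    assume "openin (lower_Vietoris X (WF X)) \<S>"
    then obtain \<F> where \<F>: "\<F> \<subseteq> Collect (finite intersection_of P relative_to WF X)" "\<Union>\<F> = \<S>"
      unfolding open_eq union_of_def arbitrary_def by auto
    have "\<F> \<subseteq> Collect P"
      using \<F>(1) P_finite unfolding relative_to_def intersection_of_def by blast
    then show "P \<S>" using P_Union \<F>(2) by blast
  next
    assume "P \<S>"
    then have "(finite intersection_of P) \<S>" by (rule finite_intersection_of_inc)
    moreover have "WF X \<inter> \<S> = \<S>" using \<open>P \<S>\<close> unfolding P_def by blast
    ultimately have "(finite intersection_of P relative_to WF X) \<S>"
      unfolding relative_to_def by blast
    then show "openin (lower_Vietoris X (WF X)) \<S>"
      unfolding open_eq by (rule arbitrary_union_of_inc)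
  qed
  then show ?thesis unfolding P_def .
qed

lemma topspace_lower_Vietoris_WF: "topspace (lower_Vietoris X (WF X)) = WF X"
proof
  show "topspace (lower_Vietoris X (WF X)) \<subseteq> WF X"
    using openin_topspace[of "lower_Vietoris X (WF X)"]
    unfolding openin_lower_Vietoris_WF by blast
  have "A \<inter> topspace X \<noteq> {}" if "A \<in> WF X" for A
    using WF_imp_nonempty[OF that] closedin_subset[OF WF_closedin[OF that]] by blast
  then have "openin (lower_Vietoris X (WF X)) (WF X)"
    unfolding openin_lower_Vietoris_WF by (intro exI[of _ "topspace X"]) auto
  then show "WF X \<subseteq> topspace (lower_Vietoris X (WF X))" by (rule openin_subset)
qed

text \<open>If \<open>A\<close> is not contained in the closed set \<open>B\<close>, then the
  complement of \<open>B\<close> is hit by \<open>A\<close> but not by \<open>B\<close>.\<close>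

lemma t0_space_lower_Vietoris_WF: "t0_space (lower_Vietoris X (WF X))"
proof -
  have sep: "\<exists>\<U>. openin (lower_Vietoris X (WF X)) \<U> \<and> A \<in> \<U> \<and> B \<notin> \<U>"
    if "A \<in> WF X" "B \<in> WF X" "\<not> A \<subseteq> B" for A B
  proof -
    have "openin X (topspace X - B)" "A \<inter> (topspace X - B) \<noteq> {}"
      using that WF_closedin closedin_subset[OF WF_closedin[of A X]] by blast+
    then show ?thesis
      using that(1) unfolding openin_lower_Vietoris_WF
      by (intro exI[of _ "{A \<in> WF X. A \<inter> (topspace X - B) \<noteq> {}}"]) blast
  qed
  show ?thesis
    unfolding t0_space_def topspace_lower_Vietoris_WF
    using sep by (metis subset_antisym)
qed

section \<open>Generic points and the map to point closures\<close>

lemma closure_of_singleton_eq_imp: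
  assumes "well_filtered_space Y" "y \<in> topspace Y" "z \<in> topspace Y"
    "Y closure_of {y} = Y closure_of {z}"
  shows "y = z"
  using assms unfolding well_filtered_space_def t0_space_closure_of_sing by blast

text \<open>Uniqueness of the generic point is automatic because well-filtered spaces are
  T0.\<close>

lemma wf_determinedI:
  assumes "\<And>(Y :: 'b topology) f. \<lbrakk>well_filtered_space Y; continuous_map X Y f\<rbrakk>
    \<Longrightarrow> \<exists>y\<in>topspace Y. Y closure_of (f ` A) = Y closure_of {y}"
  shows "wf_determined TYPE('b) X A"
  unfolding wf_determined_def
  using assms closure_of_singleton_eq_imp by metis

lemma closure_of_image_closure_of:
  assumes "continuous_map X Y f" "S \<subseteq> topspace X"
  shows "Y closure_of (f ` (X closure_of S)) = Y closure_of (f ` S)"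
proof
  show "Y closure_of (f ` (X closure_of S)) \<subseteq> Y closure_of (f ` S)"
    using assms(1) by (intro closure_of_minimal continuous_map_image_closure_subset) auto
  show "Y closure_of (f ` S) \<subseteq> Y closure_of (f ` (X closure_of S))"
    using assms(2) by (intro closure_of_mono image_mono closure_of_subset)
qed

text \<open>Continuity makes \<open>f x\<close> the generic point required for each test map
  \<open>f\<close>.\<close>

lemma point_closure_in_WF:
  assumes "x \<in> topspace X"
  shows "point_closure X x \<in> WF X"
  unfolding WF_def point_closure_def
proof (intro CollectI conjI wf_determinedI)
  fix Y :: "'a set topology" and f
  assume "continuous_map X Y f"
  then have "f x \<in> topspace Y" "Y closure_of (f ` (X closure_of {x})) = Y closure_of {f x}"
    using assms closure_of_image_closure_of[of X Y f "{x}"]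
    by (auto simp: continuous_map_def)
  then show "\<exists>y\<in>topspace Y. Y closure_of (f ` (X closure_of {x})) = Y closure_of {y}" by blast
qed simp

lemma point_closure_Int_open:
  assumes "x \<in> topspace X" "openin X U"
  shows "point_closure X x \<inter> U \<noteq> {} \<longleftrightarrow> x \<in> U"
  using assms unfolding point_closure_def by (auto simp: in_closure_of_singleton)

text \<open>The preimage of the open family given by \<open>U\<close> is \<open>U\<close>
  itself.\<close>

lemma continuous_map_point_closure:
  "continuous_map X (lower_Vietoris X (WF X)) (point_closure X)"
  unfolding continuous_map_def topspace_lower_Vietoris_WF
proof (intro conjI allI impI)
  fix \<S> assume "openin (lower_Vietoris X (WF X)) \<S>"
  then obtain U where U: "openin X U" "\<S> = {A \<in> WF X. A \<inter> U \<noteq> {}}"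
    unfolding openin_lower_Vietoris_WF by blast
  have "{x \<in> topspace X. point_closure X x \<in> \<S>} = U"
    using U openin_subset[OF U(1)] point_closure_in_WF point_closure_Int_open by fastforce
  then show "openin X {x \<in> topspace X. point_closure X x \<in> \<S>}" using U(1) by simp
qed (use point_closure_in_WF in auto)

section \<open>Extension of maps to \<open>WF X\<close> and its uniqueness\<close>

text \<open>The restricted abstraction makes the map extensional, as \<open>wf_reflection\<close>
  demands.\<close>

definition wf_extension :: "'a topology \<Rightarrow> 'b topology \<Rightarrow> ('a \<Rightarrow> 'b) \<Rightarrow> 'a set \<Rightarrow> 'b" where
  "wf_extension X Y f =
     (\<lambda>A\<in>WF X. THE y. y \<in> topspace Y \<and> Y closure_of (f ` A) = Y closure_of {y})"

lemma wf_extension: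
  assumes "well_filtered_space Y" "continuous_map X Y f" "A \<in> WF X"
  shows "wf_extension X Y f A \<in> topspace Y"
    and "Y closure_of {wf_extension X Y f A} = Y closure_of (f ` A)"
proof -
  have "\<exists>!y. y \<in> topspace Y \<and> Y closure_of (f ` A) = Y closure_of {y}"
    using WF_wf_determined[OF assms(3)] assms(1,2) unfolding wf_determined_def by blast
  from theI'[OF this] show "wf_extension X Y f A \<in> topspace Y"
    "Y closure_of {wf_extension X Y f A} = Y closure_of (f ` A)"
    using assms(3) unfolding wf_extension_def by auto
qed

text \<open>An open set meets a set iff it meets its closure, and here the two closures
  agree.\<close>

lemma wf_extension_in_open:
  assumes "well_filtered_space Y" "continuous_map X Y f" "A \<in> WF X" "openin Y W"
  shows "wf_extension X Y f A \<in> W \<longleftrightarrow> f ` A \<inter> W \<noteq> {}"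
  using openin_Int_closure_of_eq_empty[OF assms(4), of "f ` A"]
    openin_Int_closure_of_eq_empty[OF assms(4), of "{wf_extension X Y f A}"]
    wf_extension(2)[OF assms(1-3)] by auto

text \<open>The preimage of \<open>W\<close> is the open family given by the preimage of
  \<open>W\<close> under \<open>f\<close>.\<close>

lemma continuous_map_wf_extension:
  assumes Y: "well_filtered_space Y" and f: "continuous_map X Y f"
  shows "continuous_map (lower_Vietoris X (WF X)) Y (wf_extension X Y f)"
  unfolding continuous_map_def topspace_lower_Vietoris_WF
proof (intro conjI allI impI)
  fix W assume W: "openin Y W"
  have "{A \<in> WF X. wf_extension X Y f A \<in> W} = {A \<in> WF X. A \<inter> {x \<in> topspace X. f x \<in> W} \<noteq> {}}"
    using wf_extension_in_open[OF Y f _ W] closedin_subset[OF WF_closedin] by blast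
  moreover have "openin X {x \<in> topspace X. f x \<in> W}"
    using f W by (rule openin_continuous_map_preimage)
  ultimately show "openin (lower_Vietoris X (WF X)) {A \<in> WF X. wf_extension X Y f A \<in> W}"
    unfolding openin_lower_Vietoris_WF by blast
qed (use wf_extension(1)[OF Y f] in auto)

lemma wf_extension_point_closure:
  assumes Y: "well_filtered_space Y" and f: "continuous_map X Y f" and x: "x \<in> topspace X"
  shows "wf_extension X Y f (point_closure X x) = f x"
proof (rule closure_of_singleton_eq_imp[OF Y])
  show "wf_extension X Y f (point_closure X x) \<in> topspace Y"
    using wf_extension(1)[OF Y f point_closure_in_WF[OF x]] .
  show "f x \<in> topspace Y" using f x by (auto simp: continuous_map_def)
  show "Y closure_of {wf_extension X Y f (point_closure X x)} = Y closure_of {f x}"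
    using wf_extension(2)[OF Y f point_closure_in_WF[OF x]]
      closure_of_image_closure_of[OF f, of "{x}"] x
    by (simp add: point_closure_def)
qed

text \<open>The open family given by \<open>U\<close> contains \<open>A\<close> iff \<open>U\<close>
  contains some \<open>x\<close> in \<open>A\<close>, that is, iff the family contains the closure
  of some such \<open>x\<close>. So \<open>A\<close> is generic for its point closures, which forces
  uniqueness of extensions.\<close>

lemma closure_of_point_closure_image:
  assumes "A \<in> WF X"
  shows "lower_Vietoris X (WF X) closure_of (point_closure X ` A) =
    lower_Vietoris X (WF X) closure_of {A}"
proof -
  have A: "A \<subseteq> topspace X" using closedin_subset[OF WF_closedin[OF assms]] .
  have "(\<exists>x\<in>A. point_closure X x \<in> \<S>) \<longleftrightarrow> A \<in> \<S>"
    if "openin (lower_Vietoris X (WF X)) \<S>" for \<S>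
  proof -
    from that obtain U where U: "openin X U" "\<S> = {A \<in> WF X. A \<inter> U \<noteq> {}}"
      unfolding openin_lower_Vietoris_WF by blast
    have "point_closure X x \<in> \<S> \<longleftrightarrow> x \<in> U" if "x \<in> A" for x
    proof -
      have "x \<in> topspace X" using that A by (rule subsetD[rotated])
      then show ?thesis
        unfolding U(2) using point_closure_in_WF[of x X] point_closure_Int_open[OF _ U(1)] by simp
    qed
    then have "(\<exists>x\<in>A. point_closure X x \<in> \<S>) \<longleftrightarrow> A \<inter> U \<noteq> {}" by auto
    then show ?thesis using assms U(2) by simp
  qed
  then show ?thesis
    unfolding closure_of_def by (intro Collect_cong) (simp cong: imp_cong)
qed

text \<open>Since \<open>A\<close> is generic for its point closures, continuity of \<open>g\<close>
  makes \<open>g A\<close> generic for the image of \<open>A\<close> under \<open>f\<close>; T0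
  leaves only one such point.\<close>

lemma wf_extension_unique:
  assumes Y: "well_filtered_space Y" and f: "continuous_map X Y f"
    and g: "continuous_map (lower_Vietoris X (WF X)) Y g"
    and gf: "\<And>x. x \<in> topspace X \<Longrightarrow> g (point_closure X x) = f x"
    and A: "A \<in> WF X"
  shows "g A = wf_extension X Y f A"
proof (rule closure_of_singleton_eq_imp[OF Y])
  let ?Z = "lower_Vietoris X (WF X)"
  have AX: "A \<subseteq> topspace X" using closedin_subset[OF WF_closedin[OF A]] .
  show "g A \<in> topspace Y"
    using g A by (auto simp: continuous_map_def topspace_lower_Vietoris_WF)
  show "wf_extension X Y f A \<in> topspace Y" using wf_extension(1)[OF Y f A] .
  have "Y closure_of {g A} = Y closure_of (g ` (?Z closure_of {A}))"
    using closure_of_image_closure_of[OF g, of "{A}"] A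
    by (simp add: topspace_lower_Vietoris_WF)
  also have "\<dots> = Y closure_of (g ` (?Z closure_of (point_closure X ` A)))"
    using closure_of_point_closure_image[OF A] by simp
  also have "\<dots> = Y closure_of (g ` point_closure X ` A)"
    using AX
    by (intro closure_of_image_closure_of[OF g])
      (auto simp: topspace_lower_Vietoris_WF intro!: point_closure_in_WF)
  also have "g ` point_closure X ` A = f ` A"
    using AX gf by (force simp: image_comp)
  finally show "Y closure_of {g A} = Y closure_of {wf_extension X Y f A}"
    using wf_extension(2)[OF Y f A] by simp
qed

section \<open>Minimal transversals and well-filteredness of the lower Vietoris space\<close>

text \<open>The saturated images of the sets \<open>C \<inter> K\<close> form a filtered family in
  \<open>Y\<close>. None of them avoids the closure of the image of \<open>C\<close>, so that
  closure contains a point \<open>y\<close> common to all of them. The part of \<open>C\<close>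
  mapped into the closure of \<open>y\<close> still meets every \<open>K\<close>, so by minimality
  it is all of \<open>C\<close>.\<close>

lemma minimal_closed_transversal_wf_determined:
  fixes Z :: "'a topology"
  assumes filt: "filtered_family \<K>" and comp: "\<And>K. K \<in> \<K> \<Longrightarrow> compactin Z K"
    and C: "closedin Z C" and meets: "\<And>K. K \<in> \<K> \<Longrightarrow> C \<inter> K \<noteq> {}"
    and min: "\<And>D. \<lbrakk>closedin Z D; D \<subseteq> C; \<And>K. K \<in> \<K> \<Longrightarrow> D \<inter> K \<noteq> {}\<rbrakk> \<Longrightarrow> D = C"
  shows "wf_determined TYPE('b) Z C"
proof (rule wf_determinedI)
  fix Y :: "'b topology" and g
  assume Y: "well_filtered_space Y" and g: "continuous_map Z Y g"
  have CZ: "C \<subseteq> topspace Z" using closedin_subset[OF C] .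
  have gCY: "g ` C \<subseteq> topspace Y" using g CZ by (auto simp: continuous_map_def)
  define L where "L K = saturation_in Y (g ` (C \<inter> K))" for K
  have sub_L: "g ` (C \<inter> K) \<subseteq> L K" for K
    unfolding L_def using gCY by (intro saturation_in_superset) blast
  have "L ` \<K> \<subseteq> compact_saturated_sets Y"
  proof (intro image_subsetI)
    fix K assume K: "K \<in> \<K>"
    have "compactin Y (g ` (C \<inter> K))"
      using image_compactin[OF closed_Int_compactin[OF C comp[OF K]] g] .
    then show "L K \<in> compact_saturated_sets Y"
      unfolding L_def using meets[OF K] by (intro saturation_in_compact_saturated) auto
  qed
  moreover have "filtered_family (L ` \<K>)"
  proof -
    have "L K \<subseteq> L K'" if "K \<subseteq> K'" for K K'
      unfolding L_def using that by (intro saturation_in_mono) blast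
    then show ?thesis using filt unfolding filtered_family_def by (simp; meson)
  qed
  moreover have "\<not> L K \<subseteq> topspace Y - Y closure_of (g ` C)" if "K \<in> \<K>" for K
    using meets[OF that] sub_L[of K] closure_of_subset[OF gCY] by blast
  moreover have "openin Y (topspace Y - Y closure_of (g ` C))"
    by (simp add: openin_diff)
  ultimately have "\<not> \<Inter>(L ` \<K>) \<subseteq> topspace Y - Y closure_of (g ` C)"
    using Y unfolding well_filtered_space_def by blast
  then obtain y where y: "\<And>K. K \<in> \<K> \<Longrightarrow> y \<in> L K" "y \<notin> topspace Y - Y closure_of (g ` C)"
    by blast
  have yY: "y \<in> topspace Y"
    using y(1) filt unfolding filtered_family_def L_def saturation_in_def by blast
  define E where "E = C \<inter> {z \<in> topspace Z. g z \<in> Y closure_of {y}}"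
  have "E = C"
  proof (rule min)
    show "closedin Z E"
      unfolding E_def
      by (intro closedin_Int C closedin_continuous_map_preimage[OF g]) simp
    show "E \<inter> K \<noteq> {}" if K: "K \<in> \<K>" for K
    proof
      \<comment> \<open>The complement of the closure of \<open>y\<close> would be an open set
        around the image of \<open>C \<inter> K\<close>, hence would contain \<open>y\<close>, a
        point of its saturation.\<close>
      assume "E \<inter> K = {}"
      then have "g ` (C \<inter> K) \<subseteq> topspace Y - Y closure_of {y}"
        using CZ gCY unfolding E_def by blast
      moreover have "openin Y (topspace Y - Y closure_of {y})" by (simp add: openin_diff)
      ultimately have "y \<in> topspace Y - Y closure_of {y}"
        using y(1)[OF K] unfolding L_def saturation_in_def by blast
      then show False using yY by (simp add: in_closure_of_singleton)
    qed
  qed (simp add: E_def)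
  then have "Y closure_of (g ` C) \<subseteq> Y closure_of {y}"
    unfolding E_def by (intro closure_of_minimal) auto
  moreover have "Y closure_of {y} \<subseteq> Y closure_of (g ` C)"
    using y(2) yY by (intro closure_of_minimal) auto
  ultimately show "\<exists>y\<in>topspace Y. Y closure_of (g ` C) = Y closure_of {y}"
    using yY by blast
qed

text \<open>The closed subsets of \<open>WF X\<close> are the families \<open>{A \<in> WF X. A \<subseteq> C}\<close> with \<open>C\<close> closed in \<open>X\<close>.\<close>

lemma WF_wf_determined_transfer:
  fixes X :: "'a topology"
  assumes C: "closedin X C"
    and det: "wf_determined TYPE('a set) (lower_Vietoris X (WF X)) {A \<in> WF X. A \<subseteq> C}"
  shows "C \<in> WF X"
  unfolding WF_def
proof (intro CollectI conjI C wf_determinedI)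
  fix Y :: "'a set topology" and f
  assume Y: "well_filtered_space Y" and f: "continuous_map X Y f"
  let ?g = "wf_extension X Y f"
  let ?C = "{A \<in> WF X. A \<subseteq> C}"
  obtain y where y: "y \<in> topspace Y" "Y closure_of (?g ` ?C) = Y closure_of {y}"
    using det Y continuous_map_wf_extension[OF Y f] unfolding wf_determined_def by blast
  have CX: "C \<subseteq> topspace X" using closedin_subset[OF C] .
  \<comment> \<open>A point \<open>x\<close> of \<open>C\<close> has its closure in
    \<open>?C\<close>, and \<open>?g\<close> sends that closure to \<open>f x\<close>.\<close>
  have "f ` C \<subseteq> ?g ` ?C"
  proof (intro image_subsetI)
    fix x assume x: "x \<in> C"
    then have "point_closure X x \<subseteq> C"
      unfolding point_closure_def using C by (intro closure_of_minimal) auto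
    then show "f x \<in> ?g ` ?C"
      using x CX wf_extension_point_closure[OF Y f] point_closure_in_WF[of x X]
      by (intro image_eqI[of _ _ "point_closure X x"]) auto
  qed
  then have "Y closure_of (f ` C) \<subseteq> Y closure_of (?g ` ?C)" by (rule closure_of_mono)
  \<comment> \<open>Conversely, \<open>?g A\<close> lies in the closure of the image of
    \<open>A\<close>, and \<open>A \<subseteq> C\<close>.\<close>
  moreover have "?g ` ?C \<subseteq> Y closure_of (f ` C)"
  proof (intro image_subsetI)
    fix A assume A: "A \<in> ?C"
    then have "?g A \<in> Y closure_of {?g A}"
      using wf_extension(1)[OF Y f] by (auto simp: in_closure_of_singleton)
    also have "\<dots> = Y closure_of (f ` A)" using A wf_extension(2)[OF Y f] by blast
    also have "\<dots> \<subseteq> Y closure_of (f ` C)" using A by (intro closure_of_mono) blast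
    finally show "?g A \<in> Y closure_of (f ` C)" .
  qed
  then have "Y closure_of (?g ` ?C) \<subseteq> Y closure_of (f ` C)"
    by (intro closure_of_minimal) auto
  ultimately show "\<exists>y\<in>topspace Y. Y closure_of (f ` C) = Y closure_of {y}"
    using y by auto
qed

text \<open>The complementary family consists of the sets hitting one open \<open>U\<close>, and
  missing \<open>U\<close> means lying in its complement.\<close>

lemma closedin_lower_Vietoris_WF:
  assumes "closedin (lower_Vietoris X (WF X)) \<C>"
  obtains C where "closedin X C" "\<C> = {A \<in> WF X. A \<subseteq> C}"
proof -
  obtain U where U: "openin X U" "WF X - \<C> = {A \<in> WF X. A \<inter> U \<noteq> {}}"
    using assms unfolding closedin_def topspace_lower_Vietoris_WF openin_lower_Vietoris_WF
    by blast
  have sub: "\<C> \<subseteq> WF X"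
    using closedin_subset[OF assms] unfolding topspace_lower_Vietoris_WF .
  have mem: "A \<in> \<C> \<longleftrightarrow> A \<subseteq> topspace X - U" if "A \<in> WF X" for A
  proof -
    have "A \<in> WF X - \<C> \<longleftrightarrow> A \<inter> U \<noteq> {}" unfolding U(2) using that by simp
    then show ?thesis using that closedin_subset[OF WF_closedin[OF that]] by blast
  qed
  show ?thesis
  proof (rule that)
    show "closedin X (topspace X - U)" using U(1) by blast
    show "\<C> = {A \<in> WF X. A \<subseteq> topspace X - U}" using sub mem by blast
  qed
qed

lemma well_filtered_space_lower_Vietoris_WF:
  fixes X :: "'a topology"
  shows "well_filtered_space (lower_Vietoris X (WF X))"
  unfolding well_filtered_space_def
proof (intro conjI allI impI t0_space_lower_Vietoris_WF)
  let ?Z = "lower_Vietoris X (WF X)"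
  fix \<U> \<K>
  assume H: "openin ?Z \<U> \<and> \<K> \<subseteq> compact_saturated_sets ?Z \<and> filtered_family \<K> \<and> \<Inter>\<K> \<subseteq> \<U>"
  have K: "compactin ?Z K" "saturatedin ?Z K" if "K \<in> \<K>" for K
    using H that unfolding compact_saturated_sets_def by auto
  show "\<exists>K\<in>\<K>. K \<subseteq> \<U>"
  proof (rule ccontr)
    assume non: "\<not> (\<exists>K\<in>\<K>. K \<subseteq> \<U>)"
    have ne: "\<K> \<noteq> {}" using H unfolding filtered_family_def by blast
    have cl: "closedin ?Z (topspace ?Z - \<U>)" using H by blast
    have meet: "(topspace ?Z - \<U>) \<inter> K \<noteq> {}" if "K \<in> \<K>" for K
      using non that compactin_subset_topspace[OF K(1)[OF that]] by blast
    obtain \<C> where \<C>: "closedin ?Z \<C>" "\<C> \<subseteq> topspace ?Z - \<U>"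
      and meets: "\<And>K. K \<in> \<K> \<Longrightarrow> \<C> \<inter> K \<noteq> {}"
      and min: "\<And>\<D>. \<lbrakk>closedin ?Z \<D>; \<D> \<subseteq> \<C>; \<And>K. K \<in> \<K> \<Longrightarrow> \<D> \<inter> K \<noteq> {}\<rbrakk> \<Longrightarrow> \<D> = \<C>"
      using minimal_closed_transversal[OF K(1) cl meet ne] by metis
    obtain C where C: "closedin X C" "\<C> = {A \<in> WF X. A \<subseteq> C}"
      using closedin_lower_Vietoris_WF[OF \<C>(1)] .
    \<comment> \<open>The test spaces are taken over \<open>'a set\<close>, the type fixed in the
      definition of \<open>WF\<close>.\<close>
    have "wf_determined TYPE('a set) ?Z \<C>"
      using H K(1) \<C>(1) meets min
      by (intro minimal_closed_transversal_wf_determined[of \<K>]) auto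
    then have CW: "C \<in> WF X"
      using WF_wf_determined_transfer[OF C(1)] C(2) by simp
    have "C \<in> K" if "K \<in> \<K>" for K
    proof -
      obtain A where A: "A \<in> K" "A \<in> WF X" "A \<subseteq> C" using meets[OF \<open>K \<in> \<K>\<close>] C(2) by blast
      \<comment> \<open>Open families are upward closed in \<open>WF X\<close>: a larger set hits
        every open set that a smaller one hits. So \<open>A \<subseteq> C\<close> carries membership
        from \<open>A\<close> to \<open>C\<close>.\<close>
      have "C \<in> \<V>" if \<V>: "openin ?Z \<V>" "K \<subseteq> \<V>" for \<V>
      proof -
        obtain U where "\<V> = {A \<in> WF X. A \<inter> U \<noteq> {}}"
          using \<V>(1) unfolding openin_lower_Vietoris_WF by blast
        then show ?thesis using A \<V>(2) CW by blast
      qed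
      then show ?thesis using K(2)[OF that] unfolding saturatedin_def by blast
    qed
    then have "C \<in> \<U>" using H by blast
    moreover have "C \<in> \<C>" using CW C(2) by simp
    ultimately show False using \<C>(2) by blast
  qed
qed

section \<open>The universal property\<close>

theorem theorem5p14:
  fixes X :: "'a topology"
  assumes "t0_space X"
  shows "well_filtered_space (lower_Vietoris X (WF X)) \<and>
         wf_reflection TYPE('c) X (lower_Vietoris X (WF X)) (point_closure X)"
  unfolding wf_reflection_def
proof (intro conjI allI impI well_filtered_space_lower_Vietoris_WF continuous_map_point_closure)
  fix Y :: "'c topology" and f
  assume "well_filtered_space Y \<and> continuous_map X Y f"
  then have Y: "well_filtered_space Y" and f: "continuous_map X Y f" by auto
  let ?Z = "lower_Vietoris X (WF X)"
  show "\<exists>!g. g \<in> extensional (topspace ?Z) \<and> continuous_map ?Z Y g \<and>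
    (\<forall>x\<in>topspace X. g (point_closure X x) = f x)"
  proof (intro ex1I[of _ "wf_extension X Y f"] conjI ballI)
    show "wf_extension X Y f \<in> extensional (topspace ?Z)"
      by (simp add: wf_extension_def topspace_lower_Vietoris_WF)
    show "continuous_map ?Z Y (wf_extension X Y f)"
      using continuous_map_wf_extension[OF Y f] .
    show "wf_extension X Y f (point_closure X x) = f x" if "x \<in> topspace X" for x
      using wf_extension_point_closure[OF Y f that] .
    fix g
    assume g: "g \<in> extensional (topspace ?Z) \<and> continuous_map ?Z Y g \<and>
      (\<forall>x\<in>topspace X. g (point_closure X x) = f x)"
    \<comment> \<open>Outside \<open>WF X\<close> both maps are \<open>undefined\<close>, so
      agreement on \<open>WF X\<close> is enough.\<close>
    show "g = wf_extension X Y f"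
    proof (rule extensionalityI)
      show "g \<in> extensional (WF X)" using g by (simp add: topspace_lower_Vietoris_WF)
      show "wf_extension X Y f \<in> extensional (WF X)" by (simp add: wf_extension_def)
      show "g A = wf_extension X Y f A" if "A \<in> WF X" for A
        using wf_extension_unique[OF Y f _ _ that] g by blast
    qed
  qed
qed

end
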